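(* Let $p$ be a prime and let $R$ be a non-commutative ring whose order is a power of $p$. If $|\operatorname{Cent}(R)| = p + 2$, then $d(R) = \frac{1}{p^3}(p^2 + p - 1)$.
   Context: Rings are associative and not assumed to have a unity. For $r \in R$, the centralizer of $r$ is the subring $C(r) = \{s \in R : rs = sr\}$, and $\operatorname{Cent}(R) = \{C(r) : r \in R\}$ is the set of all distinct centralizers. The commutativity degree of a finite ring $R$ is $d(R) = \frac{1}{|R|^2}\sum_{r \in R} |C(r)|$, i.e. the probability that a randomly chosen pair of elements of $R$ commutes. *)

theory Defs
  imports Complex_Main "HOL-Computational_Algebra.Primes"
begin

text \<open>
  The ring \<open>R\<close> is the whole of a type of class \<^class>\<open>ring\<close>, which requires
  neither a multiplicative unit nor commutativity of multiplication.
\<close>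

definition centralizer :: "'a::ring \<Rightarrow> 'a set" where
  "centralizer r = {s. r * s = s * r}"

definition Cent :: "'a::ring set set" where
  "Cent = range centralizer"

definition commutativity_degree :: "'a::{finite,ring} itself \<Rightarrow> real" where
  "commutativity_degree _ =
     1 / (real (card (UNIV :: 'a set)))\<^sup>2 * (\<Sum>r\<in>(UNIV :: 'a set). real (card (centralizer r)))"

end

theory Submission
  imports Defs "HOL-Algebra.Coset"
begin

text \<open>
  Every element lies in its own centralizer, so the proper centralizers are \<open>p + 1\<close> proper
  additive subgroups covering \<open>R\<close>, and they intersect in the centre. The number \<open>p + 1\<close> is the
  smallest for which a group of order \<open>N = p ^ n\<close> can be covered in this way, and the cover is
  then rigid: every member has index \<open>p\<close>, and any two members meet exactly in the intersection
  of all of them. This is a counting argument. Proper subgroups have at most \<open>N / p\<close> elements.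
  Since \<open>p + 1 < p\<^sup>2\<close>, some member \<open>H\<close> has exactly \<open>N / p\<close>, and any other subgroup has at most
  the fraction \<open>1 - 1 / p\<close> of its elements outside \<open>H\<close>. So the \<open>p\<close> remaining members have just
  enough elements to cover the complement of \<open>H\<close>, and only if they have index \<open>p\<close> and do not
  overlap outside \<open>H\<close> (\<open>cover_relative_to_index_p_member\<close>). Now all members have index \<open>p\<close>, so
  each of them can play the part of \<open>H\<close>.

  Removing the common intersection from the members therefore leaves a partition of its
  complement, and counting gives that the centre has index \<open>p\<^sup>2\<close>
  (\<open>cover_by_Suc_p_subgroups\<close>). All centralizer sizes are now known: \<open>N\<close> for the \<open>N / p\<^sup>2\<close>
  central elements and \<open>N / p\<close> for the others. Summing them gives the commutativity degree.
\<close>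

section \<open>Finite additive subgroups\<close>

definition additive_subgroup :: "'a::ab_group_add set \<Rightarrow> bool" where
  "additive_subgroup H \<longleftrightarrow> 0 \<in> H \<and> (\<forall>x\<in>H. \<forall>y\<in>H. x - y \<in> H)"

lemma additive_subgroup_uminus:
  assumes "additive_subgroup H" "x \<in> H"
  shows "- x \<in> H"
  using assms unfolding additive_subgroup_def by (metis diff_0)

lemma additive_subgroup_add:
  assumes "additive_subgroup H" "x \<in> H" "y \<in> H"
  shows "x + y \<in> H"
  using additive_subgroup_uminus[OF assms(1,3)] assms
  unfolding additive_subgroup_def by (metis diff_minus_eq_add)

lemma card_additive_subgroup_dvd:
  fixes H :: "'a::{finite,ab_group_add} set"
  assumes "additive_subgroup H"
  shows "card H dvd card (UNIV :: 'a set)"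
proof -
  define G :: "'a monoid" where "G = \<lparr>carrier = UNIV, mult = (+), one = 0\<rparr>"
  have G: "group G"
  proof (rule groupI)
    show "\<exists>y\<in>carrier G. y \<otimes>\<^bsub>G\<^esub> x = \<one>\<^bsub>G\<^esub>" for x
      by (auto simp: G_def intro: exI[of _ "- x"])
  qed (auto simp: G_def algebra_simps)
  have inv: "inv\<^bsub>G\<^esub> x = - x" for x
    by (rule group.inv_equality[OF G]) (auto simp: G_def)
  have "subgroup H G"
  proof (rule group.subgroupI[OF G])
    show "H \<noteq> {}" using assms by (auto simp: additive_subgroup_def)
    show "inv\<^bsub>G\<^esub> x \<in> H" if "x \<in> H" for x
      using additive_subgroup_uminus[OF assms that] inv by simp
    show "x \<otimes>\<^bsub>G\<^esub> y \<in> H" if "x \<in> H" "y \<in> H" for x y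
      using additive_subgroup_add[OF assms that] by (simp add: G_def)
  qed (simp add: G_def)
  from group.lagrange[OF G this] show ?thesis
    by (metis G_def dvd_triv_right order_def partial_object.select_convs(1))
qed

lemma card_proper_subgroup_of_p_group:
  fixes H :: "'a::{finite,ab_group_add} set"
  assumes "prime p" "card (UNIV :: 'a set) = p ^ n" "additive_subgroup H" "H \<noteq> UNIV"
  shows "p * card H = p ^ n \<or> p\<^sup>2 * card H \<le> p ^ n"
proof -
  obtain k where k: "k \<le> n" "card H = p ^ k"
    using card_additive_subgroup_dvd[OF assms(3)] assms(1,2) divides_primepow_nat by metis
  have "card H \<noteq> card (UNIV :: 'a set)"
    using assms(4) card_subset_eq[of UNIV H] by auto
  then have "k < n" using k assms(2) by (cases "k = n") auto
  show ?thesis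
  proof (cases "Suc k = n")
    case True
    then show ?thesis using k by auto
  next
    case False
    have "p ^ (k + 2) \<le> p ^ n"
      using False \<open>k < n\<close> assms(1) by (intro power_increasing) (auto dest: prime_gt_0_nat)
    then show ?thesis using k by (simp add: power_add mult.commute power2_eq_square)
  qed
qed

text \<open>
  The addition map sends \<open>A \<times> B\<close> into the whole group, and two pairs with the same sum have
  first components that differ by an element of \<open>A \<inter> B\<close>.
\<close>

lemma card_mult_le_card_Int:
  fixes A B :: "'a::{finite,ab_group_add} set"
  assumes A: "additive_subgroup A" and B: "additive_subgroup B"
  shows "card A * card B \<le> card (A \<inter> B) * card (UNIV :: 'a set)"
proof -
  define fibre where "fibre s = {(a, b) \<in> A \<times> B. a + b = s}" for s
  have fibre: "card (fibre s) \<le> card (A \<inter> B)" for s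
  proof (cases "fibre s = {}")
    case False
    then obtain a0 b0 where 0: "a0 \<in> A" "b0 \<in> B" "a0 + b0 = s"
      by (auto simp: fibre_def)
    have "inj_on (\<lambda>(a, b). a - a0) (fibre s)"
      by (auto simp: inj_on_def fibre_def)
    moreover have "(\<lambda>(a, b). a - a0) ` fibre s \<subseteq> A \<inter> B"
    proof clarify
      fix a b assume ab: "(a, b) \<in> fibre s"
      then have "a - a0 = b0 - b"
        using 0 by (auto simp: fibre_def algebra_simps)
      then show "a - a0 \<in> A \<inter> B"
        using ab 0 A B unfolding additive_subgroup_def fibre_def
        by (metis (lifting) IntI SigmaE2 case_prodD mem_Collect_eq)
    qed
    ultimately show ?thesis
      by (intro card_inj_on_le) auto
  qed simp
  have "A \<times> B = (\<Union>s\<in>UNIV. fibre s)" by (auto simp: fibre_def)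
  then have "card (A \<times> B) \<le> (\<Sum>s\<in>UNIV. card (fibre s))"
    using card_UN_le[of UNIV fibre] by simp
  also have "\<dots> \<le> (\<Sum>s\<in>(UNIV :: 'a set). card (A \<inter> B))"
    by (intro sum_mono fibre)
  finally show ?thesis by (simp add: card_cartesian_product mult.commute)
qed

section \<open>Unions of the largest possible size\<close>

lemma card_UN_eq_sum_imp_disjoint:
  assumes I: "finite I" and fin: "\<And>i. i \<in> I \<Longrightarrow> finite (f i)"
    and eq: "(\<Sum>i\<in>I. card (f i)) \<le> card (\<Union>i\<in>I. f i)"
    and ij: "i \<in> I" "j \<in> I" "i \<noteq> j"
  shows "f i \<inter> f j = {}"
proof (rule ccontr)
  assume "f i \<inter> f j \<noteq> {}"
  then obtain x where x: "x \<in> f i" "x \<in> f j" by auto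
  \<comment> \<open>Since \<open>f i\<close> still contains \<open>x\<close>, removing it from \<open>f j\<close> does not change the union.\<close>
  define g where "g = f(j := f j - {x})"
  have "(\<Union>k\<in>I. f k) = (\<Union>k\<in>I. g k)"
    using x ij by (auto simp: g_def)
  then have "card (\<Union>k\<in>I. f k) \<le> (\<Sum>k\<in>I. card (g k))"
    using card_UN_le[OF I, of g] by simp
  also have "\<dots> < (\<Sum>k\<in>I. card (f k))"
  proof (rule sum_strict_mono_ex1[OF I])
    show "\<forall>k\<in>I. card (g k) \<le> card (f k)"
      using fin by (auto simp: g_def card_Diff1_le)
    show "\<exists>k\<in>I. card (g k) < card (f k)"
      using card_Diff1_less[OF fin[OF ij(2)] x(2)] ij(2) by (intro bexI[of _ j]) (simp_all add: g_def)
  qed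
  finally show False using eq by simp
qed

lemma tight_union:
  fixes c :: real
  assumes I: "finite I" and fin: "\<And>i. i \<in> I \<Longrightarrow> finite (f i)"
    and le: "\<And>i. i \<in> I \<Longrightarrow> real (card (f i)) \<le> c"
    and tight: "real (card I) * c \<le> real (card (\<Union>i\<in>I. f i))"
  shows "i \<in> I \<Longrightarrow> real (card (f i)) = c"
    and "i \<in> I \<Longrightarrow> j \<in> I \<Longrightarrow> i \<noteq> j \<Longrightarrow> f i \<inter> f j = {}"
proof -
  have union: "real (card (\<Union>i\<in>I. f i)) \<le> (\<Sum>i\<in>I. real (card (f i)))"
    using card_UN_le[OF I, of f] by (simp flip: of_nat_sum)
  have bound: "(\<Sum>i\<in>I. real (card (f i))) \<le> real (card I) * c"
    using sum_bounded_above[of I "\<lambda>i. real (card (f i))" c] le by simp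
  have "(\<Sum>i\<in>I. c - real (card (f i))) = 0"
    using union bound tight le sum_nonneg[of I "\<lambda>i. c - real (card (f i))"]
    by (simp add: sum_subtractf)
  then show "i \<in> I \<Longrightarrow> real (card (f i)) = c"
    using sum_nonneg_eq_0_iff[of I "\<lambda>i. c - real (card (f i))"] I le by simp
  have "(\<Sum>i\<in>I. card (f i)) \<le> card (\<Union>i\<in>I. f i)"
    using order_trans[OF bound tight] by (simp flip: of_nat_sum)
  then show "i \<in> I \<Longrightarrow> j \<in> I \<Longrightarrow> i \<noteq> j \<Longrightarrow> f i \<inter> f j = {}"
    using card_UN_eq_sum_imp_disjoint[of I f] I fin by blast
qed

section \<open>Covers of a p-group by p + 1 proper subgroups\<close>

text \<open>
  At most \<open>(1 - 1 / p) * card A\<close> elements of a subgroup \<open>A\<close> lie outside \<open>H\<close>, because \<open>A \<inter> H\<close> has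
  index at most \<open>p\<close> in \<open>A\<close>. With \<open>card A \<le> N / p\<close>, the \<open>p\<close> members other than \<open>H\<close> cover at most
  \<open>p (1 - 1 / p) N / p = N - N / p\<close> elements, exactly the size of the complement of \<open>H\<close>. So all
  these estimates are equalities.
\<close>

lemma cover_relative_to_index_p_member:
  fixes F :: "'a::{finite,ab_group_add} set set"
  assumes p: "p > 1"
    and sub: "\<And>A. A \<in> F \<Longrightarrow> additive_subgroup A"
    and small: "\<And>A. A \<in> F \<Longrightarrow> p * card A \<le> card (UNIV :: 'a set)"
    and cover: "\<Union>F = UNIV" and cardF: "card F = p + 1"
    and H: "H \<in> F" "p * card H = card (UNIV :: 'a set)"
  shows "A \<in> F \<Longrightarrow> p * card A = card (UNIV :: 'a set)"
    and "A \<in> F \<Longrightarrow> B \<in> F \<Longrightarrow> A \<noteq> B \<Longrightarrow> A \<inter> B \<subseteq> H"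
proof -
  define N where "N = real (card (UNIV :: 'a set))"
  define q where "q = real p"
  define c where "c = (1 - 1 / q) * (N / q)"
  have q: "q > 1" and N: "N > 0"
    using p by (simp_all add: q_def N_def card_gt_0_iff)
  have small': "real (card A) \<le> N / q" if "A \<in> F" for A
  proof -
    have "q * real (card A) \<le> N"
      using small[OF that] unfolding N_def q_def by (simp flip: of_nat_mult)
    then show ?thesis using q by (simp add: field_simps)
  qed
  have cardH: "real (card H) = N / q"
  proof -
    have "q * real (card H) = N"
      using H(2) unfolding N_def q_def by (simp flip: of_nat_mult)
    then show ?thesis using q by (simp add: field_simps)
  qed
  have outside: "real (card (A - H)) \<le> (1 - 1 / q) * card A" if A: "A \<in> F" for A
  proof -
    have "real (card A) * real (card H) \<le> real (card (A \<inter> H)) * N"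
      using card_mult_le_card_Int[OF sub[OF A] sub[OF H(1)]]
      unfolding N_def by (simp flip: of_nat_mult)
    then have "real (card A) / q \<le> real (card (A \<inter> H))"
      using N q by (simp add: cardH field_simps)
    moreover have "card (A - H) + card (A \<inter> H) = card A"
      by (simp add: card_Diff_subset_Int card_mono)
    ultimately show ?thesis by (simp add: left_diff_distrib flip: of_nat_add)
  qed
  have le: "real (card (A - H)) \<le> c" if "A \<in> F - {H}" for A
  proof -
    have "(1 - 1 / q) * card A \<le> c"
      unfolding c_def using small'[of A] that q by (intro mult_left_mono) auto
    then show ?thesis using outside[of A] that by simp
  qed
  have qc: "q * c = N - N / q"
    using q by (simp add: c_def field_simps)
  have "(\<Union>A\<in>F - {H}. A - H) = UNIV - H" using cover by auto
  moreover have "real (card (UNIV - H)) = N - N / q"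
    using cardH N_def
    by (simp add: card_Diff_subset card_mono of_nat_diff)
  moreover have "card (F - {H}) = p"
    using cardF H(1) by (simp add: card_Diff_singleton)
  ultimately have tight: "real (card (F - {H})) * c \<le> real (card (\<Union>A\<in>F - {H}. A - H))"
    using qc by (simp flip: q_def)
  note T = tight_union[of "F - {H}" "\<lambda>A. A - H" c, OF _ _ le tight]
  show "p * card A = card (UNIV :: 'a set)" if A: "A \<in> F"
  proof (cases "A = H")
    case False
    have "c \<le> (1 - 1 / q) * card A"
      using T(1)[of A] outside[OF A] A False by simp
    then have "N / q \<le> card A"
      unfolding c_def using q by (subst (asm) mult_le_cancel_left_pos) auto
    then have "real (p * card A) \<ge> N"
      using q by (simp add: field_simps q_def)
    then show ?thesis using small[OF A] unfolding N_def by linarith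
  qed (use H in simp)
  show "A \<inter> B \<subseteq> H" if "A \<in> F" "B \<in> F" "A \<noteq> B"
    using T(2)[of A B] that by (cases "A = H"; cases "B = H") auto
qed

text \<open>
  Some member has index \<open>p\<close>: a proper subgroup of any other index has at most \<open>N / p\<^sup>2\<close>
  elements, and \<open>p + 1\<close> such sets are too small to cover, because \<open>p + 1 < p\<^sup>2\<close>. Once all
  pairs of members are known to meet in \<open>\<Inter>F\<close>, comparing sizes outside \<open>\<Inter>F\<close> gives
  \<open>N - z = (p + 1) (N / p - z)\<close> for \<open>z = card (\<Inter>F)\<close>, hence \<open>z = N / p\<^sup>2\<close>.
\<close>

lemma cover_by_Suc_p_subgroups:
  fixes F :: "'a::{finite,ab_group_add} set set"
  assumes p: "prime p" and N: "card (UNIV :: 'a set) = p ^ n"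
    and sub: "\<And>A. A \<in> F \<Longrightarrow> additive_subgroup A"
    and proper: "\<And>A. A \<in> F \<Longrightarrow> A \<noteq> UNIV"
    and cover: "\<Union>F = UNIV" and cardF: "card F = p + 1"
  shows "A \<in> F \<Longrightarrow> p * card A = card (UNIV :: 'a set)"
    and "p\<^sup>2 * card (\<Inter>F) = card (UNIV :: 'a set)"
proof -
  have p1: "p > 1" using p by (rule prime_gt_1_nat)
  have dich: "p * card A = p ^ n \<or> p\<^sup>2 * card A \<le> p ^ n" if "A \<in> F" for A
    using card_proper_subgroup_of_p_group[OF p N sub[OF that] proper[OF that]] .
  have small: "p * card A \<le> card (UNIV :: 'a set)" if "A \<in> F" for A
  proof -
    have "p * card A \<le> p\<^sup>2 * card A" using p1 by (simp add: power2_eq_square)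
    then show ?thesis using dich[OF that] N by linarith
  qed
  obtain H where H: "H \<in> F" "p * card H = card (UNIV :: 'a set)"
  proof (rule ccontr)
    assume no: "\<not> thesis"
    have "p\<^sup>2 * p ^ n = p\<^sup>2 * card (\<Union>F)" using cover N by simp
    also have "\<dots> \<le> p\<^sup>2 * (\<Sum>A\<in>F. card A)"
      using card_Union_le_sum_card[of F] by (intro mult_left_mono) auto
    also have "\<dots> = (\<Sum>A\<in>F. p\<^sup>2 * card A)" by (rule sum_distrib_left)
    also have "\<dots> \<le> (\<Sum>A\<in>F. p ^ n)"
      using dich no that N by (intro sum_mono) metis
    also have "\<dots> = (p + 1) * p ^ n" using cardF by simp
    finally have "p\<^sup>2 \<le> p + 1"
      using p1 by (subst (asm) mult_le_cancel2) simp
    moreover have "2 * p \<le> p\<^sup>2" using p1 by (simp add: power2_eq_square)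
    ultimately show False using p1 by linarith
  qed
  have index: "p * card A = card (UNIV :: 'a set)" if "A \<in> F" for A
    by (rule cover_relative_to_index_p_member(1)[OF p1 sub small cover cardF H that])
  then show "A \<in> F \<Longrightarrow> p * card A = card (UNIV :: 'a set)" .
  \<comment> \<open>Each member now serves as the subgroup relative to which the others do not overlap.\<close>
  have meet: "A \<inter> B = \<Inter>F" if "A \<in> F" "B \<in> F" "A \<noteq> B" for A B
  proof -
    have "A \<inter> B \<subseteq> C" if "C \<in> F" for C
      by (rule cover_relative_to_index_p_member(2)
          [OF p1 sub small cover cardF that index[OF that] \<open>A \<in> F\<close> \<open>B \<in> F\<close> \<open>A \<noteq> B\<close>])
    then show ?thesis using that by blast
  qed
  have "UNIV - \<Inter>F = (\<Union>A\<in>F. A - \<Inter>F)" using cover by auto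
  also have "card \<dots> = (\<Sum>A\<in>F. card (A - \<Inter>F))"
    using meet by (intro card_UN_disjoint) auto
  finally have count: "card (UNIV - \<Inter>F) = (\<Sum>A\<in>F. card (A - \<Inter>F))" .
  define z where "z = real (card (\<Inter>F))"
  define M where "M = real (card (UNIV :: 'a set))"
  have "real (card (UNIV - \<Inter>F)) = M - z"
    by (simp add: M_def z_def card_Diff_subset card_mono of_nat_diff)
  moreover have "real (card (A - \<Inter>F)) = M / p - z" if "A \<in> F" for A
  proof -
    have "real (card (A - \<Inter>F)) = real (card A) - z"
      using that by (subst card_Diff_subset) (auto simp: z_def of_nat_diff card_mono Inter_lower)
    moreover have "real p * real (card A) = M"
      using index[OF that] unfolding M_def by (simp flip: of_nat_mult)
    ultimately show ?thesis using p1 by (simp add: eq_divide_eq mult.commute)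
  qed
  ultimately have "M - z = (p + 1) * (M / p - z)"
    using count cardF by simp
  then have "real p ^ 2 * z = M"
    using p1 by (simp add: field_simps power2_eq_square)
  then show "p\<^sup>2 * card (\<Inter>F) = card (UNIV :: 'a set)"
    unfolding z_def M_def by (simp flip: of_nat_mult of_nat_power)
qed

section \<open>Centralizers and the commutativity degree\<close>

lemma additive_subgroup_centralizer: "additive_subgroup (centralizer r)"
  by (simp add: additive_subgroup_def centralizer_def algebra_simps)

text \<open>
  An element is central if and only if it commutes with every element, that is, lies in every
  centralizer; the improper ones impose no condition.
\<close>

lemma Inter_proper_centralizers:
  "\<Inter>(Cent - {UNIV}) = {r :: 'a::ring. centralizer r = UNIV}"
proof -
  have "\<Inter>(Cent - {UNIV}) = \<Inter>(Cent :: 'a set set)" by auto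
  also have "\<dots> = {r. \<forall>s. r \<in> centralizer s}" by (auto simp: Cent_def)
  also have "\<dots> = {r. centralizer r = UNIV}"
    by (simp add: centralizer_def set_eq_iff eq_commute)
  finally show ?thesis .
qed

lemma commutativity_degree_eq:
  fixes p :: nat
  assumes p: "p > 0"
    and Z: "p\<^sup>2 * card {r :: 'a::{finite,ring}. centralizer r = UNIV} = card (UNIV :: 'a set)"
    and C: "\<And>r :: 'a. centralizer r \<noteq> UNIV \<Longrightarrow> p * card (centralizer r) = card (UNIV :: 'a set)"
  shows "commutativity_degree TYPE('a) = 1 / real p ^ 3 * (real p ^ 2 + real p - 1)"
proof -
  define Z where "Z = {r :: 'a. centralizer r = UNIV}"
  define N where "N = real (card (UNIV :: 'a set))"
  have N: "N > 0" by (simp add: N_def card_gt_0_iff)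
  have cardZ: "real (card Z) = N / p ^ 2"
  proof -
    have "real p ^ 2 * real (card Z) = N"
      using Z unfolding N_def Z_def by (simp flip: of_nat_mult of_nat_power)
    then show ?thesis using p by (simp add: field_simps)
  qed
  have cardC: "real (card (centralizer r)) = N / p" if "r \<notin> Z" for r
  proof -
    have "real p * real (card (centralizer r)) = N"
      using C[of r] that unfolding N_def Z_def by (simp flip: of_nat_mult)
    then show ?thesis using p by (simp add: field_simps)
  qed
  have "(\<Sum>r\<in>(UNIV :: 'a set). real (card (centralizer r))) =
      (\<Sum>r\<in>Z. real (card (centralizer r))) + (\<Sum>r\<in>UNIV - Z. real (card (centralizer r)))"
    by (subst sum.subset_diff[of Z]) (auto simp: add.commute)
  also have "(\<Sum>r\<in>Z. real (card (centralizer r))) = (\<Sum>r\<in>Z. N)"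
    by (intro sum.cong) (auto simp: Z_def N_def)
  also have "(\<Sum>r\<in>UNIV - Z. real (card (centralizer r))) = (\<Sum>r\<in>UNIV - Z. N / p)"
    by (intro sum.cong) (auto simp: cardC)
  also have "(\<Sum>r\<in>Z. N) + (\<Sum>r\<in>UNIV - Z. N / p) = N / p ^ 2 * N + (N - N / p ^ 2) * (N / p)"
    by (simp add: card_Diff_subset of_nat_diff card_mono cardZ flip: N_def)
  finally have sum: "(\<Sum>r\<in>(UNIV :: 'a set). real (card (centralizer r))) = \<dots>" .
  have "N / p ^ 2 * N + (N - N / p ^ 2) * (N / p) =
      N\<^sup>2 * (1 / real p ^ 3 * (real p ^ 2 + real p - 1))"
    using p by (simp add: divide_simps) (simp add: algebra_simps power2_eq_square power3_eq_cube)
  then show ?thesis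
    unfolding commutativity_degree_def sum using N by (simp flip: N_def)
qed

theorem proposition5p4:
  fixes p :: nat
  assumes "prime p"
    and "\<exists>n. card (UNIV :: 'a::{finite,ring} set) = p ^ n"
    and "\<exists>x y :: 'a. x * y \<noteq> y * x"
    and "card (Cent :: 'a set set) = p + 2"
  shows "commutativity_degree TYPE('a) = 1 / real p ^ 3 * (real p ^ 2 + real p - 1)"
proof -
  obtain n where n: "card (UNIV :: 'a set) = p ^ n" using assms(2) by blast
  define F where "F = (Cent :: 'a set set) - {UNIV}"
  have "centralizer (0 :: 'a) = UNIV" by (simp add: centralizer_def)
  then have "(UNIV :: 'a set) \<in> Cent" unfolding Cent_def by (metis rangeI)
  then have cardF: "card F = p + 1"
    using assms(4) by (simp add: F_def card_Diff_singleton)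
  have sub: "additive_subgroup A" if "A \<in> F" for A
    using that additive_subgroup_centralizer by (auto simp: F_def Cent_def)
  have proper: "A \<noteq> UNIV" if "A \<in> F" for A
    using that by (simp add: F_def)
  have cover: "\<Union>F = UNIV"
  proof -
    have "r \<in> \<Union>F" for r
    proof (cases "centralizer r = UNIV")
      case True
      \<comment> \<open>A central element lies in all proper centralizers, and there is at least one.\<close>
      then have "r \<in> \<Inter>F" unfolding F_def Inter_proper_centralizers by simp
      moreover have "F \<noteq> {}" using cardF by auto
      ultimately show ?thesis by blast
    next
      case False
      then have "centralizer r \<in> F" by (simp add: F_def Cent_def)
      moreover have "r \<in> centralizer r" by (simp add: centralizer_def)
      ultimately show ?thesis by blast
    qed
    then show ?thesis by blast
  qed
  note cover_facts = cover_by_Suc_p_subgroups[OF assms(1) n sub proper cover cardF]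
  show ?thesis
  proof (rule commutativity_degree_eq)
    show "p > 0" using assms(1) by (rule prime_gt_0_nat)
    show "p\<^sup>2 * card {r :: 'a. centralizer r = UNIV} = card (UNIV :: 'a set)"
      using cover_facts(2) by (simp add: F_def Inter_proper_centralizers)
    show "p * card (centralizer r) = card (UNIV :: 'a set)" if "centralizer r \<noteq> UNIV" for r :: 'a
      using cover_facts(1)[of "centralizer r"] that by (simp add: F_def Cent_def)
  qed
qed

end
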